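(* For every positive integer $k$ there is a constant $c_k>0$, depending only on $k$, such that for every $v\in\mathbb{N}=\{1,2,\dots\}$ and every $n\ge \max(v,2)$, almost surely, $$\mathbf{P}\{D_{n+j}(v)=k\ \ \forall j\ge 0\mid T_n\}\ \ge\ c_k\,\mathbf{1}_{[D_n(v)=k]} .$$
   Context: The random friend tree process $(T_n)_{n\ge 2}$ is defined as follows. $T_2$ is a single edge joining vertices labelled $1$ and $2$. For $n\ge 2$, given $T_n$ (and the past of the process), $V_n$ is chosen uniformly at random in $\{1,\dots,n\}$, and then $W_n$ is a uniformly random neighbour of $V_n$ in $T_n$; $T_{n+1}$ is obtained from $T_n$ by adding a new vertex labelled $n+1$ joined by an edge to $W_n$. Thus $T_n$ is a tree with vertex set $[n]=\{1,\dots,n\}$. For $v\in[n]$, $D_n(v)$ is the degree of $v$ in $T_n$. *)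

theory Defs
  imports "HOL-Probability.Probability"
begin

text \<open>A simple graph on positive integers is represented by its edge set.  Nothing is lost for the
  trees \<open>T\<^sub>n\<close>, \<open>n \<ge> 2\<close>, whose vertex set \<open>{1..n}\<close> is the union of the edges.\<close>

type_synonym graph = "nat set set"

definition neighbours :: "graph \<Rightarrow> nat \<Rightarrow> nat set"
  where "neighbours G v = {w. {v, w} \<in> G}"

definition vdegree :: "graph \<Rightarrow> nat \<Rightarrow> nat"
  where "vdegree G v = card (neighbours G v)"

definition gen_sigma :: "'a measure \<Rightarrow> ('a \<Rightarrow> 'b) \<Rightarrow> 'a measure"
  where "gen_sigma M X = vimage_algebra (space M) X (count_space UNIV)"

definition cond_prob_given :: "'a measure \<Rightarrow> 'a measure \<Rightarrow> ('a \<Rightarrow> bool) \<Rightarrow> 'a \<Rightarrow> real"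
  where "cond_prob_given M F P = real_cond_exp M F (indicator {\<omega> \<in> space M. P \<omega>})"

text \<open>The sigma-algebra generated by \<open>T\<^sub>2, \<dots>, T\<^sub>n\<close> and by \<open>V\<^sub>i, W\<^sub>i\<close> for \<open>2 \<le> i < n\<close>,
  and the one generated by these variables together with \<open>V\<^sub>n\<close>.\<close>

definition past ::
  "'a measure \<Rightarrow> (nat \<Rightarrow> 'a \<Rightarrow> graph) \<Rightarrow> (nat \<Rightarrow> 'a \<Rightarrow> nat) \<Rightarrow> (nat \<Rightarrow> 'a \<Rightarrow> nat) \<Rightarrow> nat \<Rightarrow> 'a measure"
  where "past M T V W n = sigma (space M)
    ((\<Union>i\<in>{2..n}. sets (gen_sigma M (T i))) \<union>
     (\<Union>i\<in>{2..<n}. sets (gen_sigma M (V i)) \<union> sets (gen_sigma M (W i))))"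

definition past_with_V ::
  "'a measure \<Rightarrow> (nat \<Rightarrow> 'a \<Rightarrow> graph) \<Rightarrow> (nat \<Rightarrow> 'a \<Rightarrow> nat) \<Rightarrow> (nat \<Rightarrow> 'a \<Rightarrow> nat) \<Rightarrow> nat \<Rightarrow> 'a measure"
  where "past_with_V M T V W n = sigma (space M)
    (sets (past M T V W n) \<union> sets (gen_sigma M (V n)))"

text \<open>In \<open>W_uniform\<close>, \<^const>\<open>pmf_of_set\<close> is applied to a set that is finite and nonempty
  only almost surely; its unspecified value elsewhere is irrelevant, as the equation is only
  required almost everywhere.\<close>

locale random_friend_tree = prob_space M
  for M :: "'a measure"
    and T :: "nat \<Rightarrow> 'a \<Rightarrow> graph"
    and V :: "nat \<Rightarrow> 'a \<Rightarrow> nat"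
    and W :: "nat \<Rightarrow> 'a \<Rightarrow> nat" +
  assumes T_measurable: "\<And>n. n \<ge> 2 \<Longrightarrow> T n \<in> measurable M (count_space UNIV)"
    and V_measurable: "\<And>n. n \<ge> 2 \<Longrightarrow> V n \<in> measurable M (count_space UNIV)"
    and W_measurable: "\<And>n. n \<ge> 2 \<Longrightarrow> W n \<in> measurable M (count_space UNIV)"
    and T_initial: "AE \<omega> in M. T 2 \<omega> = {{1, 2}}"
    and V_uniform: "\<And>n x. n \<ge> 2 \<Longrightarrow>
      AE \<omega> in M. cond_prob_given M (past M T V W n) (\<lambda>\<omega>'. V n \<omega>' = x) \<omega>
        = pmf (pmf_of_set {1..n}) x"
    and W_uniform: "\<And>n x. n \<ge> 2 \<Longrightarrow>
      AE \<omega> in M. cond_prob_given M (past_with_V M T V W n) (\<lambda>\<omega>'. W n \<omega>' = x) \<omega>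
        = pmf (pmf_of_set (neighbours (T n \<omega>) (V n \<omega>))) x"
    and T_step: "\<And>n. n \<ge> 2 \<Longrightarrow> AE \<omega> in M. T (n + 1) \<omega> = insert {n + 1, W n \<omega>} (T n \<omega>)"

end

theory Submission
  imports Defs
begin

text \<open>While \<open>v\<close> has degree \<open>k\<close>, its degree grows at step \<open>m\<close> with probability
  \<open>(1/m) \<Sum>\<^sub>u 1/D(u)\<close>, the sum being over the \<open>k\<close> neighbours \<open>u\<close> of \<open>v\<close>.  If the \<open>D(u)\<close>
  stayed bounded these probabilities would have a divergent sum.  What saves the claim is that a
  neighbour \<open>u\<close> attracts new vertices the faster the more it already has: each leaf \<open>l\<close> hanging at \<open>u\<close> has
  \<open>u\<close> as its only neighbour, so choosing \<open>V = l\<close> forces \<open>W = u\<close>.  Hence the number \<open>L\<close> of leaves at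
  \<open>u\<close> (other than \<open>v\<close>) goes up with probability at least \<open>(L + 1/k)/m\<close>, the \<open>1/k\<close> coming from
  \<open>V = v\<close>.  It goes down with probability \<open>L/(m D(u))\<close>, which is at most \<open>1/m\<close>, and \<open>u\<close> causes an
  attachment to \<open>v\<close> with probability \<open>1/(m D(u))\<close>, where \<open>D(u) \<ge> L + 1\<close>.

  All three rates carry the same factor \<open>1/m\<close>, so they can be balanced by a potential that does not
  depend on time.  Take the product of \<open>f(L\<^sub>u)\<close> over the neighbours \<open>u\<close> of \<open>v\<close> as long as \<open>v\<close> has
  degree \<open>k\<close>, and \<open>0\<close> otherwise.  One step changes at most one factor, so the potential is a
  submartingale as soon as
  \<open>(L + 1/k) (f(L+1) - f(L)) \<ge> (L/D) (f(L) - f(L-1)) + f(L)/D\<close> whenever \<open>D \<ge> L + 1\<close>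
  (\<open>weight_drift\<close>, \<open>potential_drift\<close>).  For large \<open>L\<close> this asks for increments of order \<open>1/L\<^sup>2\<close>,
  which are summable; so an increasing solution with \<open>0 < f(0) \<le> f \<le> 1\<close> exists, and an explicit one
  is \<open>weight\<close>.

  The potential is at most \<open>1\<close>, vanishes once the degree has left \<open>k\<close>, and is at least \<open>f(0)\<^sup>k\<close> when
  the degree is \<open>k\<close>.  The submartingale property, restricted to any event \<open>A\<close> of the
  \<open>\<sigma>\<close>-algebra of \<open>T\<^sub>n\<close>, therefore bounds the probability that \<open>A\<close> occurs and the degree stays at \<open>k\<close>
  up to time \<open>n + J\<close> from below by \<open>f(0)\<^sup>k\<close> times the probability that \<open>A\<close> occurs and
  \<open>D\<^sub>n(v) = k\<close>, for every \<open>J\<close> (\<open>prob_degree_frozen\<close>).  Letting \<open>J\<close> tend to infinity and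
  varying \<open>A\<close> gives the conditional statement with \<open>c\<^sub>k = f(0)\<^sup>k\<close>.\<close>

section \<open>A bounded weight on leaf counts\<close>

text \<open>The function \<open>L / (L + B)\<close> has increments of the order \<open>1/L\<^sup>2\<close> that the drift inequality needs at
  large \<open>L\<close>, but it vanishes at \<open>0\<close>.  Its value there is replaced by the largest \<open>f(0)\<close> that the
  inequality admits at \<open>L = 0\<close>, namely \<open>f(1)/(k + 1)\<close>.  At \<open>L = 1\<close> the inequality wants
  \<open>f(0) \<ge> 4 / ((B + 1) (B + 2))\<close> if the gain \<open>1/k\<close> is ignored, and the two conditions agree for
  \<open>B = 4 k + 2\<close>.\<close>

definition weight :: "nat \<Rightarrow> nat \<Rightarrow> real"
  where "weight k L = (if L = 0 then 1 / ((4 * real k + 3) * (real k + 1))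
    else real L / (real L + 4 * real k + 2))"

lemma weight_pos: "weight k L > 0"
  by (auto simp: weight_def add_nonneg_pos)

lemma weight_le_1: "weight k L \<le> 1"
proof -
  have "1 * 1 \<le> (4 * real k + 3) * (real k + 1)"
    by (intro mult_mono) auto
  then show ?thesis
    by (auto simp: weight_def divide_simps)
qed

lemma weight_Suc: "weight k L \<le> weight k (Suc L)"
proof (cases L)
  case 0
  have "1 / ((4 * real k + 3) * (real k + 1)) \<le> 1 / ((4 * real k + 3) * 1)"
    by (intro divide_left_mono mult_left_mono) auto
  then show ?thesis
    using 0 by (simp add: weight_def add.commute)
next
  case (Suc l)
  then show ?thesis
    by (simp add: weight_def divide_simps) (simp add: algebra_simps)
qed

lemma weight_ge: "weight k 0 \<le> weight k L"
  by (induction L) (auto intro: order_trans weight_Suc)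

text \<open>This is the case \<open>D = L + 1\<close>, in which \<open>u\<close> is adjacent to \<open>v\<close> and its \<open>L\<close> leaves only.  By the
  choice of the constants it is an equality at \<open>L = 0\<close>, and at \<open>L = 1\<close> up to the gain \<open>1/k\<close>; from
  \<open>L = 2\<close> on it reduces to a polynomial inequality, which \<open>B \<ge> 6\<close> makes true.\<close>

lemma weight_drift_tight:
  assumes "k \<ge> 1"
  shows "real L / (real L + 1) * (weight k L - weight k (L - 1)) + weight k L / (real L + 1)
    \<le> (real L + 1 / real k) * (weight k (Suc L) - weight k L)"
proof -
  define K where "K = real k"
  have K: "K \<ge> 1" using assms by (simp add: K_def)
  consider "L = 0" | "L = 1" | "L \<ge> 2" by linarith
  then show ?thesis
  proof cases
    case 1
    have "1 / ((4 * K + 3) * (K + 1)) = 1 / K * (1 / (4 * K + 3) - 1 / ((4 * K + 3) * (K + 1)))"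
      using K by (simp add: divide_simps; simp add: algebra_simps)
    then show ?thesis
      using 1 by (simp add: weight_def K_def add.commute)
  next
    case 2
    have w: "weight k 0 = 1 / ((4 * K + 3) * (K + 1))" "weight k 1 = 1 / (4 * K + 3)"
      "weight k 2 = 1 / (2 * K + 2)"
      by (auto simp: weight_def K_def divide_simps)
    have "1 / 2 * (1 / (4 * K + 3) - 1 / ((4 * K + 3) * (K + 1))) + 1 / (4 * K + 3) / 2
        = 1 / (2 * K + 2) - 1 / (4 * K + 3)"
      using K by (simp add: divide_simps; simp add: algebra_simps)
    also have "\<dots> = 1 * (1 / (2 * K + 2) - 1 / (4 * K + 3))" by simp
    also have "\<dots> \<le> (1 + 1 / K) * (1 / (2 * K + 2) - 1 / (4 * K + 3))"
      using K by (intro mult_right_mono) (auto simp: divide_simps)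
    finally show ?thesis
      using 2 w by (simp add: numeral_2_eq_2 K_def)
  next
    case 3
    define x where "x = real L"
    define b where "b = 4 * K + 2"
    have x: "x \<ge> 2" using 3 by (simp add: x_def)
    have b: "b \<ge> 6" using K by (simp add: b_def)
    have w: "weight k L = x / (x + b)" "weight k (L - 1) = (x - 1) / (x - 1 + b)"
      "weight k (Suc L) = (x + 1) / (x + 1 + b)"
      using 3 by (auto simp: weight_def x_def b_def K_def of_nat_diff algebra_simps)
    have d1: "x / (x + b) - (x - 1) / (x - 1 + b) = b / ((x + b) * (x + b - 1))"
      using x b by (simp add: divide_simps; simp add: algebra_simps)
    have d2: "(x + 1) / (x + 1 + b) - x / (x + b) = b / ((x + b) * (x + b + 1))"
      using x b by (simp add: divide_simps; simp add: algebra_simps)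
    \<comment> \<open>The polynomial of the next step, expanded around \<open>x = 2\<close>, where it is \<open>b\<^sup>2 - 4 b - 3\<close>.\<close>
    have "0 \<le> (b - 1) * (x - 2) * (x + 2) + b * (b - 3) * (x - 2) + (b - 6) * (b + 2) + 9"
      using x b by (intro add_nonneg_nonneg mult_nonneg_nonneg) auto
    then have poly: "0 \<le> b * (x + 1) * (x + b - 1) - b * (x + b + 1) - (x + b + 1) * (x + b - 1)"
      by (simp add: algebra_simps)
    have "x * (b / ((x + b) * (x + b + 1)))
          - (x / (x + 1) * (b / ((x + b) * (x + b - 1))) + x / (x + b) / (x + 1))
        = x / ((x + 1) * (x + b) * (x + b + 1) * (x + b - 1))
          * (b * (x + 1) * (x + b - 1) - b * (x + b + 1) - (x + b + 1) * (x + b - 1))"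
      using x b by (simp add: divide_simps; simp add: algebra_simps)
    also have "\<dots> \<ge> 0"
      using x b poly by (intro mult_nonneg_nonneg divide_nonneg_nonneg) auto
    finally have "x / (x + 1) * (b / ((x + b) * (x + b - 1))) + x / (x + b) / (x + 1)
        \<le> x * (b / ((x + b) * (x + b + 1)))" by simp
    also have "\<dots> \<le> (x + 1 / K) * (b / ((x + b) * (x + b + 1)))"
      using x b K by (intro mult_right_mono) auto
    finally show ?thesis
      unfolding w d1 d2 x_def[symmetric] K_def[symmetric] .
  qed
qed

text \<open>Since \<open>f\<close> is increasing, both losses shrink as \<open>D\<close> grows, so \<open>D = L + 1\<close> is the worst case.\<close>

lemma weight_drift:
  assumes "k \<ge> 1" and "d \<ge> L + 1"
  shows "real L / real d * (weight k L - weight k (L - 1)) + weight k L / real d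
    \<le> (real L + 1 / real k) * (weight k (Suc L) - weight k L)"
proof -
  have 0: "weight k (L - 1) \<le> weight k L"
    using weight_Suc[of k "L - 1"] by (cases L) auto
  have "real L / real d * (weight k L - weight k (L - 1)) \<le> real L / (real L + 1) * (weight k L - weight k (L - 1))"
    using assms 0 by (intro mult_right_mono divide_left_mono) auto
  moreover have "weight k L / real d \<le> weight k L / (real L + 1)"
    using assms weight_pos[of k L] by (intro divide_left_mono) auto
  ultimately show ?thesis
    using weight_drift_tight[OF assms(1), of L] by linarith
qed

section \<open>Growing graphs and their leaves\<close>

text \<open>An invariant that almost surely all \<open>T\<^sub>m\<close> share: loop-free on \<open>{1..m}\<close>, and without
  isolated vertices, so that the uniform choice of a neighbour makes sense.\<close>

definition spanning_graph :: "nat \<Rightarrow> graph \<Rightarrow> bool"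
  where "spanning_graph m G \<longleftrightarrow> (\<forall>e\<in>G. \<exists>a\<in>{1..m}. \<exists>b\<in>{1..m}. a \<noteq> b \<and> e = {a, b})
    \<and> (\<forall>x\<in>{1..m}. neighbours G x \<noteq> {})"

lemma neighbours_sym: "x \<in> neighbours G y \<longleftrightarrow> y \<in> neighbours G x"
  by (simp add: neighbours_def insert_commute[of x])

lemma neighbours_range:
  assumes "spanning_graph m G" and "y \<in> neighbours G x"
  shows "y \<in> {1..m} \<and> x \<in> {1..m} \<and> x \<noteq> y"
proof -
  have "{x, y} \<in> G" using assms(2) by (simp add: neighbours_def)
  then obtain a b where "a \<in> {1..m}" "b \<in> {1..m}" "a \<noteq> b" "{x, y} = {a, b}"
    using assms(1) unfolding spanning_graph_def by blast
  then show ?thesis unfolding doubleton_eq_iff by metis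
qed

lemma neighbours_subset: "spanning_graph m G \<Longrightarrow> neighbours G x \<subseteq> {1..m}"
  by (rule subsetI) (simp only: neighbours_range)

lemma finite_neighbours: "spanning_graph m G \<Longrightarrow> finite (neighbours G x)"
  by (rule finite_subset[OF neighbours_subset finite_atLeastAtMost])

lemma neighbours_nonempty: "spanning_graph m G \<Longrightarrow> x \<in> {1..m} \<Longrightarrow> neighbours G x \<noteq> {}"
  by (simp add: spanning_graph_def)

lemma finite_spanning_graphs: "finite {G. spanning_graph m G}"
proof (rule finite_subset)
  show "{G. spanning_graph m G} \<subseteq> Pow (Pow {1..m})"
  proof (intro subsetI PowI CollectI)
    fix G e x assume "G \<in> {G. spanning_graph m G}" "e \<in> G" "x \<in> e"
    then obtain a b where "a \<in> {1..m}" "b \<in> {1..m}" "e = {a, b}"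
      unfolding spanning_graph_def by blast
    then show "x \<in> {1..m}" using \<open>x \<in> e\<close> by blast
  qed
qed auto

lemma neighbours_insert:
  "neighbours (insert {s, w} G) x
    = neighbours G x \<union> (if x = w then {s} else {}) \<union> (if x = s then {w} else {})"
  by (auto simp: neighbours_def doubleton_eq_iff)

lemma spanning_graph_edge: "spanning_graph 2 {{1, 2}}"
proof -
  have "\<exists>a\<in>{1..2::nat}. \<exists>b\<in>{1..2}. a \<noteq> b \<and> {1, 2} = {a, b}"
    by (intro bexI[where x = 1] bexI[where x = 2]) auto
  moreover have "neighbours {{1, 2}} x \<noteq> {}" if "x \<in> {1..2}" for x
  proof -
    have "x = 1 \<or> x = 2" using that by auto
    moreover have "2 \<in> neighbours {{1, 2}} 1" "1 \<in> neighbours {{1, 2}} 2"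
      by (auto simp: neighbours_def)
    ultimately show ?thesis by blast
  qed
  ultimately show ?thesis
    unfolding spanning_graph_def by blast
qed

lemma spanning_graph_grow:
  assumes G: "spanning_graph m G" and w: "w \<in> {1..m}"
  shows "spanning_graph (m + 1) (insert {m + 1, w} G)"
  unfolding spanning_graph_def
proof (intro conjI ballI)
  fix e assume "e \<in> insert {m + 1, w} G"
  then show "\<exists>a\<in>{1..m + 1}. \<exists>b\<in>{1..m + 1}. a \<noteq> b \<and> e = {a, b}"
  proof
    assume "e = {m + 1, w}"
    moreover have "w \<in> {1..m + 1}" "m + 1 \<in> {1..m + 1}" "m + 1 \<noteq> w" using w by auto
    ultimately show ?thesis by blast
  next
    assume "e \<in> G"
    then obtain a b where "a \<in> {1..m}" "b \<in> {1..m}" "a \<noteq> b \<and> e = {a, b}"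
      using G unfolding spanning_graph_def by blast
    moreover from this have "a \<in> {1..m + 1}" "b \<in> {1..m + 1}" by auto
    ultimately show ?thesis by blast
  qed
next
  fix x assume "x \<in> {1..m + 1}"
  then consider "x = m + 1" | "x \<in> {1..m}" by fastforce
  then show "neighbours (insert {m + 1, w} G) x \<noteq> {}"
    using neighbours_nonempty[OF G] by cases (auto simp: neighbours_insert)
qed

text \<open>Every vertex counted here contributes \<open>1/m\<close> to the probability of attaching to \<open>u\<close>.  The vertex
  \<open>v\<close>, which is a leaf if \<open>k = 1\<close>, is left out: its contribution \<open>1/(k m)\<close> is added separately, and an
  attachment to it is not the loss of a leaf but the end of the period in which \<open>v\<close> has degree \<open>k\<close>.\<close>

definition leaves_at :: "graph \<Rightarrow> nat \<Rightarrow> nat \<Rightarrow> nat set"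
  where "leaves_at G v u = {l. l \<noteq> v \<and> neighbours G l = {u}}"

text \<open>A new vertex attached to \<open>u\<close> becomes a leaf of \<open>u\<close>, and a vertex that receives the new
  vertex ceases to be a leaf.  A vertex \<open>w\<close> cannot become a leaf of \<open>u\<close> by receiving one, as it
  already had a neighbour.\<close>

lemma leaves_at_insert:
  assumes G: "spanning_graph m G" and w: "w \<in> {1..m}" "w \<noteq> v" and v: "v \<le> m"
  shows "leaves_at (insert {m + 1, w} G) v u
    = (if w = u then insert (m + 1) (leaves_at G v u) else leaves_at G v u - {w})"
proof -
  have new: "neighbours G (m + 1) = {}"
    using neighbours_range[OF G, of _ "m + 1"] by auto
  have w0: "neighbours G w \<noteq> {}" "m + 1 \<notin> neighbours G w"
    using neighbours_nonempty[OF G w(1)] neighbours_range[OF G, of "m + 1" w] by auto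
  have *: "w \<notin> leaves_at G v u" if "w = u"
    using that neighbours_range[OF G, of u u] by (auto simp: leaves_at_def)
  have wm: "w \<noteq> m + 1" "v \<noteq> m + 1" using w v by auto
  have wi: "neighbours (insert {m + 1, w} G) w \<noteq> {u}"
    using w0 wm by (auto simp: neighbours_insert)
  show ?thesis
  proof (rule set_eqI)
    fix l
    consider "l = w" | "l = m + 1" | "l \<noteq> w" "l \<noteq> m + 1" by blast
    then show "l \<in> leaves_at (insert {m + 1, w} G) v u \<longleftrightarrow>
      l \<in> (if w = u then insert (m + 1) (leaves_at G v u) else leaves_at G v u - {w})"
    proof cases
      case 1
      then show ?thesis using wi * wm by (auto simp: leaves_at_def)
    next
      case 2
      then show ?thesis using new wm by (auto simp: leaves_at_def neighbours_insert)
    next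
      case 3
      then show ?thesis by (auto simp: leaves_at_def neighbours_insert)
    qed
  qed
qed

lemma leaves_at_subset: "leaves_at G v u \<subseteq> neighbours G u - {v}"
proof
  fix l assume l: "l \<in> leaves_at G v u"
  then have "u \<in> neighbours G l" by (simp add: leaves_at_def)
  then have "l \<in> neighbours G u" by (subst neighbours_sym)
  then show "l \<in> neighbours G u - {v}" using l by (simp add: leaves_at_def)
qed

lemma finite_leaves_at: "spanning_graph m G \<Longrightarrow> finite (leaves_at G v u)"
  by (rule finite_subset[OF leaves_at_subset], rule finite_Diff, rule finite_neighbours)

text \<open>A neighbour \<open>u\<close> of \<open>v\<close> that were a leaf of \<open>u'\<close> would have \<open>v\<close> as its only neighbour.  So attaching
  to a neighbour of \<open>v\<close> destroys no leaf that is counted, and the effects on different factors of the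
  potential exclude each other.\<close>

lemma leaves_at_not_neighbour:
  assumes G: "spanning_graph m G" and "u \<in> neighbours G v" and "u' \<in> neighbours G v"
  shows "u \<notin> leaves_at G v u'"
proof
  assume "u \<in> leaves_at G v u'"
  then have "neighbours G u = {u'}" by (simp add: leaves_at_def)
  moreover have "v \<in> neighbours G u" using assms(2) by (subst neighbours_sym)
  ultimately show False using neighbours_range[OF G assms(3)] by simp
qed

section \<open>The potential and its one-step drift\<close>

definition potential :: "nat \<Rightarrow> nat \<Rightarrow> graph \<Rightarrow> real"
  where "potential k v G = (if vdegree G v = k
    then \<Prod>u\<in>neighbours G v. weight k (card (leaves_at G v u)) else 0)"

lemma potential_le_1: "potential k v G \<le> 1"
  by (auto simp: potential_def intro!: prod_le_1 weight_le_1 less_imp_le[OF weight_pos])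

lemma potential_nonneg: "potential k v G \<ge> 0"
  by (auto simp: potential_def intro!: prod_nonneg less_imp_le[OF weight_pos])

lemma potential_lower:
  "vdegree G v = k \<Longrightarrow> weight k 0 ^ k \<le> potential k v G"
proof -
  assume k: "vdegree G v = k"
  have "weight k 0 ^ k = (\<Prod>u\<in>neighbours G v. weight k 0)"
    using k by (simp add: vdegree_def)
  also have "\<dots> \<le> (\<Prod>u\<in>neighbours G v. weight k (card (leaves_at G v u)))"
    by (intro prod_mono) (auto intro: weight_ge less_imp_le[OF weight_pos])
  finally show ?thesis using k by (simp add: potential_def)
qed

lemma prod_single_change:
  fixes r :: "'b \<Rightarrow> real"
  assumes "finite N" and "\<And>x y. x \<in> N \<Longrightarrow> y \<in> N \<Longrightarrow> r x \<noteq> 1 \<Longrightarrow> r y \<noteq> 1 \<Longrightarrow> x = y"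
  shows "prod r N = 1 + (\<Sum>x\<in>N. r x - 1)"
proof (cases "\<exists>x\<in>N. r x \<noteq> 1")
  case False
  then show ?thesis by simp
next
  case True
  then obtain x where x: "x \<in> N" "r x \<noteq> 1" by blast
  then have "\<forall>y\<in>N - {x}. r y = 1" using assms(2) by blast
  then show ?thesis
    using x assms(1) by (simp add: prod.remove[of N x] sum.remove[of N x])
qed

text \<open>The conditional law of \<open>W\<^sub>m\<close> given \<open>T\<^sub>m = G\<close>.\<close>

definition attach_prob :: "nat \<Rightarrow> graph \<Rightarrow> nat \<Rightarrow> real"
  where "attach_prob m G w = (\<Sum>x\<in>{1..m}. pmf (pmf_of_set {1..m}) x * pmf (pmf_of_set (neighbours G x)) w)"

lemma attach_prob_nonneg: "attach_prob m G w \<ge> 0"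
  by (auto simp: attach_prob_def intro!: sum_nonneg)

lemma attach_prob_eq:
  assumes G: "spanning_graph m G"
  shows "attach_prob m G w = (\<Sum>x\<in>neighbours G w. 1 / real (vdegree G x)) / real m"
proof (cases "m = 0")
  case True
  then show ?thesis by (simp add: attach_prob_def)
next
  case False
  have "attach_prob m G w
      = (\<Sum>x\<in>{1..m}. if x \<in> neighbours G w then 1 / real (vdegree G x) / real m else 0)"
    unfolding attach_prob_def
  proof (rule sum.cong[OF refl])
    fix x assume x: "x \<in> {1..m}"
    then show "pmf (pmf_of_set {1..m}) x * pmf (pmf_of_set (neighbours G x)) w
        = (if x \<in> neighbours G w then 1 / real (vdegree G x) / real m else 0)"
      using finite_neighbours[OF G, of x] neighbours_nonempty[OF G x]
      by (simp add: vdegree_def neighbours_sym[of w G x] pmf_of_set indicator_def)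
  qed
  also have "\<dots> = (\<Sum>x\<in>neighbours G w. 1 / real (vdegree G x) / real m)"
    using neighbours_subset[OF G, of w] by (intro sum.mono_neutral_cong_right) auto
  finally show ?thesis by (simp add: sum_divide_distrib)
qed

lemma sum_attach_prob:
  assumes G: "spanning_graph m G" and m: "m \<ge> 1"
  shows "(\<Sum>w\<in>{1..m}. attach_prob m G w) = 1"
proof -
  have "(\<Sum>w\<in>{1..m}. attach_prob m G w)
      = (\<Sum>x\<in>{1..m}. pmf (pmf_of_set {1..m}) x * (\<Sum>w\<in>{1..m}. pmf (pmf_of_set (neighbours G x)) w))"
    unfolding attach_prob_def by (subst sum.swap) (simp add: sum_distrib_left)
  also have "\<dots> = (\<Sum>x\<in>{1..m}. pmf (pmf_of_set {1..m}) x)"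
  proof (rule sum.cong[OF refl])
    fix x assume x: "x \<in> {1..m}"
    have "(\<Sum>w\<in>{1..m}. pmf (pmf_of_set (neighbours G x)) w) = 1"
      using finite_neighbours[OF G, of x] neighbours_nonempty[OF G x] neighbours_subset[OF G, of x]
      by (intro sum_pmf_eq_1) (auto simp: set_pmf_of_set)
    then show "pmf (pmf_of_set {1..m}) x * (\<Sum>w\<in>{1..m}. pmf (pmf_of_set (neighbours G x)) w)
        = pmf (pmf_of_set {1..m}) x" by simp
  qed
  also have "\<dots> = 1"
    using m by (intro sum_pmf_eq_1) (auto simp: set_pmf_of_set)
  finally show ?thesis .
qed

text \<open>Attaching to \<open>w \<noteq> v\<close> multiplies the factor of \<open>u\<close> by a ratio \<open>r w u\<close>, and for each \<open>w\<close> at most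
  one of these ratios differs from \<open>1\<close>.  The expected relative change of the product is therefore the
  sum over \<open>u\<close> of the expected changes of the single factors, less the probability of attaching to
  \<open>v\<close>.  That probability is \<open>\<Sum>\<^sub>u 1/(m D(u))\<close>, so it can be charged to the neighbours \<open>u\<close>
  one by one, and each share is covered by \<open>weight_drift\<close>.\<close>

lemma potential_drift:
  assumes G: "spanning_graph m G" and v: "v \<in> {1..m}" and k: "k \<ge> 1"
  shows "potential k v G \<le> (\<Sum>w\<in>{1..m}. attach_prob m G w * potential k v (insert {m + 1, w} G))"
proof (cases "vdegree G v = k")
  case False
  then have "potential k v G = 0" by (simp add: potential_def)
  also have "0 \<le> (\<Sum>w\<in>{1..m}. attach_prob m G w * potential k v (insert {m + 1, w} G))"
    by (intro sum_nonneg mult_nonneg_nonneg attach_prob_nonneg potential_nonneg)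
  finally show ?thesis .
next
  case True
  define N where "N = neighbours G v"
  define L where "L u = card (leaves_at G v u)" for u
  define P where "P = potential k v G"
  define q where "q = attach_prob m G"
  define L' where "L' w u = (if w = u then Suc (L u) else if w \<in> leaves_at G v u then L u - 1 else L u)" for w u
  define r where "r w u = weight k (L' w u) / weight k (L u)" for w u
  have finN: "finite N" using finite_neighbours[OF G] by (simp add: N_def)
  have N_range: "u \<in> {1..m}" "u \<noteq> v" if "u \<in> N" for u
    using that neighbours_range[OF G, of u v] by (auto simp: N_def)
  have m: "m \<ge> 1" using v by auto
  have P0: "P \<ge> 0" by (simp add: P_def potential_nonneg)
  have q0: "q w \<ge> 0" for w by (simp add: q_def attach_prob_nonneg)
  have P_eq: "P = (\<Prod>u\<in>N. weight k (L u))"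
    using True by (simp add: P_def potential_def N_def L_def)

  \<comment> \<open>The product over \<open>N\<close> turns into a sum, since at most one factor changes.\<close>
  have new: "potential k v (insert {m + 1, w} G) = P + (\<Sum>u\<in>N. P * (r w u - 1))"
    if w: "w \<in> {1..m} - {v}" for w
  proof -
    have nb: "neighbours (insert {m + 1, w} G) v = N"
      using w v by (auto simp: neighbours_insert N_def)
    have card: "card (leaves_at (insert {m + 1, w} G) v u) = L' w u" if u: "u \<in> N" for u
    proof -
      have "m + 1 \<notin> leaves_at G v u"
        using leaves_at_subset[of G v u] neighbours_subset[OF G, of u] by auto
      then show ?thesis
        using leaves_at_insert[OF G, of w v u] w v u finite_leaves_at[OF G, of v u]
        by (auto simp: N_def L'_def L_def)
    qed
    have "potential k v (insert {m + 1, w} G) = (\<Prod>u\<in>N. weight k (L' w u))"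
      using nb True card by (simp add: potential_def vdegree_def N_def)
    also have "\<dots> = (\<Prod>u\<in>N. weight k (L u) * r w u)"
      using weight_pos by (simp add: r_def less_imp_neq[THEN not_sym])
    also have "\<dots> = P * (\<Prod>u\<in>N. r w u)"
      by (simp add: prod.distrib P_eq)
    also have "(\<Prod>u\<in>N. r w u) = 1 + (\<Sum>u\<in>N. r w u - 1)"
    proof (rule prod_single_change[OF finN])
      fix x y assume xy: "x \<in> N" "y \<in> N" and "r w x \<noteq> 1" "r w y \<noteq> 1"
      then have "(w = x \<or> w \<in> leaves_at G v x) \<and> (w = y \<or> w \<in> leaves_at G v y)"
        using weight_pos[of k] by (auto simp: r_def L'_def less_imp_neq[THEN not_sym] split: if_splits)
      moreover have "x \<notin> leaves_at G v y" "y \<notin> leaves_at G v x"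
        using xy leaves_at_not_neighbour[OF G] by (auto simp: N_def)
      ultimately show "x = y" by (auto simp: leaves_at_def)
    qed
    finally show ?thesis by (simp add: distrib_left sum_distrib_left)
  qed

  \<comment> \<open>The balance for a single neighbour \<open>u\<close> of \<open>v\<close>: gain, loss of a leaf, and its share of the attachments to \<open>v\<close>.\<close>
  have drift_u: "0 \<le> (\<Sum>w\<in>{1..m} - {v}. q w * (r w u - 1)) - 1 / real (vdegree G u) / real m"
    if u: "u \<in> N" for u
  proof -
    define d where "d = vdegree G u"
    define lv where "lv = leaves_at G v u"
    have vu: "v \<in> neighbours G u" using u by (simp add: N_def neighbours_sym)
    have lv_sub: "lv \<subseteq> {1..m} - {v}" "finite lv"
      using leaves_at_subset[of G v u] neighbours_subset[OF G, of u] finite_leaves_at[OF G]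
      by (auto simp: lv_def)
    have u_lv: "u \<notin> lv"
      using leaves_at_not_neighbour[OF G] u by (simp add: N_def lv_def)
    have L_lv: "L u = card lv" by (simp add: L_def lv_def)
    have "card (insert v lv) \<le> d"
      unfolding d_def vdegree_def using leaves_at_subset[of G v u] vu
      by (intro card_mono finite_neighbours[OF G]) (auto simp: lv_def)
    moreover have "card (insert v lv) = L u + 1"
      using lv_sub by (simp add: L_lv card_insert_if) (auto simp: lv_def leaves_at_def)
    ultimately have d: "d \<ge> L u + 1" by simp
    have q_leaf: "q l = 1 / real d / real m" if "l \<in> lv" for l
      using that by (simp add: q_def attach_prob_eq[OF G] lv_def leaves_at_def d_def)
    \<comment> \<open>Each leaf at \<open>u\<close> has degree \<open>1\<close> and \<open>v\<close> has degree \<open>k\<close>; the other neighbours of \<open>u\<close> are dropped.\<close>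
    have "(real (L u) + 1 / real k) / real m
        = (\<Sum>x\<in>insert v lv. 1 / real (vdegree G x)) / real m"
    proof -
      have "(\<Sum>x\<in>lv. 1 / real (vdegree G x)) = (\<Sum>x\<in>lv. 1)"
        by (intro sum.cong) (auto simp: lv_def leaves_at_def vdegree_def)
      moreover have "v \<notin> lv" by (simp add: lv_def leaves_at_def)
      ultimately show ?thesis
        using lv_sub True by (simp add: L_lv)
    qed
    also have "\<dots> \<le> q u"
      unfolding q_def attach_prob_eq[OF G]
      using leaves_at_subset[of G v u] vu finite_neighbours[OF G, of u]
      by (intro divide_right_mono sum_mono2) (auto simp: lv_def)
    finally have q_u: "(real (L u) + 1 / real k) / real m \<le> q u" .
    have sum_eq: "(\<Sum>w\<in>{1..m} - {v}. q w * (r w u - 1))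
        = q u * (weight k (Suc (L u)) / weight k (L u) - 1)
          + real (L u) / real d / real m * (weight k (L u - 1) / weight k (L u) - 1)"
    proof -
      have "(\<Sum>w\<in>{1..m} - {v}. q w * (r w u - 1)) = (\<Sum>w\<in>insert u lv. q w * (r w u - 1))"
        using N_range[OF u] lv_sub weight_pos[of k "L u"]
        by (intro sum.mono_neutral_right) (auto simp: r_def L'_def lv_def)
      also have "\<dots> = q u * (r u u - 1) + (\<Sum>w\<in>lv. q w * (r w u - 1))"
        using lv_sub u_lv by simp
      also have "(\<Sum>w\<in>lv. q w * (r w u - 1))
          = (\<Sum>w\<in>lv. 1 / real d / real m * (weight k (L u - 1) / weight k (L u) - 1))"
        using u_lv q_leaf by (intro sum.cong) (auto simp: r_def L'_def lv_def)
      finally show ?thesis by (simp add: r_def L'_def L_lv)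
    qed
    have "0 \<le> ((real (L u) + 1 / real k) * (weight k (Suc (L u)) - weight k (L u))
        - (real (L u) / real d * (weight k (L u) - weight k (L u - 1)) + weight k (L u) / real d))
        / (real m * weight k (L u))"
      using weight_drift[OF k d] weight_pos[of k "L u"]
      by (intro divide_nonneg_nonneg) auto
    also have "\<dots> = (real (L u) + 1 / real k) / real m * (weight k (Suc (L u)) / weight k (L u) - 1)
          + real (L u) / real d / real m * (weight k (L u - 1) / weight k (L u) - 1)
          - 1 / real d / real m"
      using weight_pos[of k "L u"] m d k by (simp add: divide_simps; simp add: algebra_simps)
    also have "\<dots> \<le> q u * (weight k (Suc (L u)) / weight k (L u) - 1)
          + real (L u) / real d / real m * (weight k (L u - 1) / weight k (L u) - 1)
          - 1 / real d / real m"
      using q_u weight_Suc[of k "L u"] weight_pos[of k "L u"]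
      by (intro diff_right_mono add_right_mono mult_right_mono) auto
    finally show ?thesis by (simp only: sum_eq d_def)
  qed

  have q_v: "q v = (\<Sum>u\<in>N. 1 / real (vdegree G u) / real m)"
    by (simp add: q_def attach_prob_eq[OF G] N_def sum_divide_distrib)
  have q_sum: "(\<Sum>w\<in>{1..m} - {v}. q w) = 1 - q v"
    using sum_attach_prob[OF G m] v by (simp add: q_def sum_diff1)
  have swap: "(\<Sum>w\<in>{1..m} - {v}. q w * (\<Sum>u\<in>N. P * (r w u - 1)))
      = P * (\<Sum>u\<in>N. \<Sum>w\<in>{1..m} - {v}. q w * (r w u - 1))"
    unfolding sum_distrib_left by (subst sum.swap) (simp only: mult.left_commute)
  have "0 \<le> P * (\<Sum>u\<in>N. (\<Sum>w\<in>{1..m} - {v}. q w * (r w u - 1)) - 1 / real (vdegree G u) / real m)"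
    using P0 drift_u by (intro mult_nonneg_nonneg sum_nonneg)
  also have "\<dots> = (\<Sum>w\<in>{1..m} - {v}. q w * (\<Sum>u\<in>N. P * (r w u - 1))) - P * q v"
    unfolding swap q_v sum_subtractf by (simp only: right_diff_distrib)
  also have "\<dots> = (\<Sum>w\<in>{1..m} - {v}. q w * (P + (\<Sum>u\<in>N. P * (r w u - 1)))) - P"
    by (simp add: distrib_left sum.distrib q_sum[simplified] sum_distrib_right[symmetric] left_diff_distrib)
  also have "\<dots> = (\<Sum>w\<in>{1..m} - {v}. q w * potential k v (insert {m + 1, w} G)) - P"
    by (simp only: new cong: sum.cong)
  also have "\<dots> \<le> (\<Sum>w\<in>{1..m}. q w * potential k v (insert {m + 1, w} G)) - P"
    using q0 potential_nonneg by (intro diff_right_mono sum_mono2) auto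
  finally show ?thesis by (simp add: P_def q_def)
qed

section \<open>Conditional probabilities tested on events\<close>

lemma subalgebra_gen_sigma:
  assumes "X \<in> measurable M (count_space UNIV)"
  shows "subalgebra M (gen_sigma M X)"
  using measurable_sets[OF assms]
  by (auto simp: subalgebra_def gen_sigma_def sets_vimage_algebra2)

lemma in_gen_sigma: "{\<omega> \<in> space M. Q (X \<omega>)} \<in> sets (gen_sigma M X)"
proof -
  have "X -` {x. Q x} \<inter> space M \<in> sets (gen_sigma M X)"
    unfolding gen_sigma_def by (rule in_vimage_algebra) simp
  also have "X -` {x. Q x} \<inter> space M = {\<omega> \<in> space M. Q (X \<omega>)}" by auto
  finally show ?thesis .
qed

context prob_space
begin

lemma measure_inter_of_cond_prob:
  assumes F: "subalgebra M F" and B: "B \<in> sets F"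
    and P: "{\<omega> \<in> space M. P \<omega>} \<in> sets M"
    and c: "AE \<omega> in M. \<omega> \<in> B \<longrightarrow> cond_prob_given M F P \<omega> = c"
  shows "prob {\<omega> \<in> B. P \<omega>} = prob B * c"
proof -
  interpret finite_measure_subalgebra M F
    by unfold_locales (rule F)
  have BM[measurable]: "B \<in> sets M" using F B by (auto simp: subalgebra_def)
  have E: "B \<inter> {\<omega> \<in> space M. P \<omega>} = {\<omega> \<in> B. P \<omega>}"
    using sets.sets_into_space[OF BM] by auto
  have "prob {\<omega> \<in> B. P \<omega>} = (\<integral>\<omega>\<in>B. indicator {\<omega> \<in> space M. P \<omega>} \<omega> \<partial>M)"
    using BM P by (simp add: set_lebesgue_integral_def E flip: indicator_inter_arith)
  also have "\<dots> = (\<integral>\<omega>\<in>B. real_cond_exp M F (indicator {\<omega> \<in> space M. P \<omega>}) \<omega> \<partial>M)"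
    by (rule real_cond_exp_intA) (use P B in \<open>auto simp: integrable_real_indicator less_top[symmetric]\<close>)
  also have "\<dots> = (\<integral>\<omega>\<in>B. c \<partial>M)"
  proof (rule set_lebesgue_integral_cong_AE[OF BM])
    show "(\<lambda>\<omega>. real_cond_exp M F (indicator {\<omega> \<in> space M. P \<omega>}) \<omega>) \<in> borel_measurable M"
      by simp
    show "AE \<omega>\<in>B in M. real_cond_exp M F (indicator {\<omega> \<in> space M. P \<omega>}) \<omega> = c"
      using c by (simp add: cond_prob_given_def)
  qed simp
  also have "\<dots> = prob B * c"
    using BM by (simp add: set_lebesgue_integral_def)
  finally show ?thesis .
qed

text \<open>The event \<open>A\<close> where the bound fails belongs to \<open>F\<close>.  Integrating over it shows that the nonnegative
  deficit has an integral that is at most \<open>0\<close>, so \<open>A\<close> is null.\<close>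

lemma cond_prob_given_lower_bound:
  assumes F: "subalgebra M F" and S: "S \<in> sets F"
    and P: "{\<omega> \<in> space M. P \<omega>} \<in> sets M"
    and le: "\<And>A. A \<in> sets F \<Longrightarrow> c * prob (A \<inter> S) \<le> prob {\<omega> \<in> A. P \<omega>}"
  shows "AE \<omega> in M. c * indicator S \<omega> \<le> cond_prob_given M F P \<omega>"
proof -
  interpret finite_measure_subalgebra M F
    by unfold_locales (rule F)
  define E where "E = {\<omega> \<in> space M. P \<omega>}"
  define g where "g = real_cond_exp M F (indicator E)"
  define A where "A = {\<omega> \<in> space M. g \<omega> < c * indicator S \<omega>}"
  have SF[measurable]: "S \<in> sets F" by (rule S)
  have EM[measurable]: "E \<in> sets M" using P by (simp add: E_def)
  have SM[measurable]: "S \<in> sets M" using F S by (auto simp: subalgebra_def)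
  have gF[measurable]: "g \<in> borel_measurable F" by (simp add: g_def)
  have spF: "space F = space M" using F by (simp add: subalgebra_def)
  have AF[measurable]: "A \<in> sets F" unfolding A_def spF[symmetric] by measurable
  have AM[measurable]: "A \<in> sets M" using F AF by (auto simp: subalgebra_def)
  have int_E: "integrable M (indicator E :: 'a \<Rightarrow> real)"
    using EM by (simp add: integrable_real_indicator less_top[symmetric])
  have int_g: "integrable M g" unfolding g_def by (rule real_cond_exp_int(1)[OF int_E])
  define h where "h \<omega> = indicator A \<omega> * (c * indicator S \<omega> - g \<omega>)" for \<omega>
  have i1: "integrable M (\<lambda>\<omega>. indicator A \<omega> * g \<omega>)"
    using integrable_mult_indicator[OF AM int_g] by simp
  have i2: "integrable M (\<lambda>\<omega>. c * indicator (A \<inter> S) \<omega> :: real)"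
    by (intro integrable_mult_right) (simp add: integrable_real_indicator less_top[symmetric])
  have h_eq: "h = (\<lambda>\<omega>. c * indicator (A \<inter> S) \<omega> - indicator A \<omega> * g \<omega>)"
    by (auto simp: h_def fun_eq_iff indicator_def)
  have "(\<integral>\<omega>. indicator A \<omega> * g \<omega> \<partial>M) = (\<integral>\<omega>\<in>A. indicator E \<omega> \<partial>M)"
    using real_cond_exp_intA[OF int_E AF] by (simp add: g_def set_lebesgue_integral_def)
  also have "\<dots> = prob (A \<inter> E)"
    by (simp add: set_lebesgue_integral_def flip: indicator_inter_arith)
  also have "A \<inter> E = {\<omega> \<in> A. P \<omega>}"
    using sets.sets_into_space[OF AM] by (auto simp: E_def)
  finally have "(\<integral>\<omega>. h \<omega> \<partial>M) = c * prob (A \<inter> S) - prob {\<omega> \<in> A. P \<omega>}"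
    unfolding h_eq using i1 i2 by simp
  then have "(\<integral>\<omega>. h \<omega> \<partial>M) \<le> 0" using le[OF AF] by simp
  moreover have nn: "h \<omega> \<ge> 0" for \<omega>
    by (auto simp: h_def A_def indicator_def)
  moreover have "0 \<le> (\<integral>\<omega>. h \<omega> \<partial>M)"
    by (rule integral_nonneg_AE) (simp add: nn)
  ultimately have "(\<integral>\<omega>. h \<omega> \<partial>M) = 0" by linarith
  moreover have "integrable M h" unfolding h_eq using i1 i2 by simp
  ultimately have "AE \<omega> in M. h \<omega> = 0"
    using integral_nonneg_eq_0_iff_AE[of M h] nn by simp
  then show ?thesis
  proof (rule AE_mp, intro AE_I2 impI)
    fix \<omega> assume "\<omega> \<in> space M" "h \<omega> = 0"
    then show "c * indicator S \<omega> \<le> cond_prob_given M F P \<omega>"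
      by (auto simp: h_def A_def g_def E_def cond_prob_given_def indicator_def not_less split: if_splits)
  qed
qed

text \<open>Graphs form an uncountable type, but \<open>T\<^sub>n\<close> takes only finitely many values almost surely;
  this turns expectations into the finite sums of \<open>potential_drift\<close>.\<close>

lemma expectation_finite_valued:
  fixes f :: "'c \<Rightarrow> real"
  assumes K: "finite K" and X: "AE \<omega> in M. \<omega> \<in> B \<longrightarrow> X \<omega> \<in> K"
    and meas: "\<And>x. x \<in> K \<Longrightarrow> {\<omega> \<in> B. X \<omega> = x} \<in> sets M"
    and f[measurable]: "(\<lambda>\<omega>. f (X \<omega>)) \<in> borel_measurable M" and B[measurable]: "B \<in> sets M"
  shows "expectation (\<lambda>\<omega>. indicator B \<omega> * f (X \<omega>)) = (\<Sum>x\<in>K. f x * prob {\<omega> \<in> B. X \<omega> = x})"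
proof -
  have "expectation (\<lambda>\<omega>. indicator B \<omega> * f (X \<omega>))
      = expectation (\<lambda>\<omega>. \<Sum>x\<in>K. f x * indicator {\<omega> \<in> B. X \<omega> = x} \<omega>)"
  proof (rule integral_cong_AE)
    show "(\<lambda>\<omega>. \<Sum>x\<in>K. f x * indicator {\<omega> \<in> B. X \<omega> = x} \<omega>) \<in> borel_measurable M"
      using meas by (intro borel_measurable_sum borel_measurable_times) auto
    show "AE \<omega> in M. indicator B \<omega> * f (X \<omega>) = (\<Sum>x\<in>K. f x * indicator {\<omega> \<in> B. X \<omega> = x} \<omega>)"
      using X
    proof (rule AE_mp, intro AE_I2 impI)
      fix \<omega> assume K': "\<omega> \<in> B \<longrightarrow> X \<omega> \<in> K"
      have "(\<Sum>x\<in>K. f x * indicator {\<omega> \<in> B. X \<omega> = x} \<omega>)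
          = (\<Sum>x\<in>K. if x = X \<omega> then indicator B \<omega> * f x else 0)"
        by (intro sum.cong) (auto simp: indicator_def)
      also have "\<dots> = indicator B \<omega> * f (X \<omega>)"
        using K K' by (auto simp: indicator_def)
      finally show "indicator B \<omega> * f (X \<omega>) = (\<Sum>x\<in>K. f x * indicator {\<omega> \<in> B. X \<omega> = x} \<omega>)" ..
    qed
  qed measurable
  also have "\<dots> = (\<Sum>x\<in>K. f x * prob {\<omega> \<in> B. X \<omega> = x})"
  proof (subst Bochner_Integration.integral_sum)
    show "integrable M (\<lambda>\<omega>. f x * indicator {\<omega> \<in> B. X \<omega> = x} \<omega>)" if "x \<in> K" for x
      using meas[OF that] by (intro integrable_mult_right) (simp add: integrable_real_indicator less_top[symmetric])
    show "(\<Sum>x\<in>K. expectation (\<lambda>\<omega>. f x * indicator {\<omega> \<in> B. X \<omega> = x} \<omega>))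
        = (\<Sum>x\<in>K. f x * prob {\<omega> \<in> B. X \<omega> = x})"
      using meas by (intro sum.cong) auto
  qed
  finally show ?thesis .
qed

end

section \<open>The law of one step of the process\<close>

context random_friend_tree
begin

lemma in_events:
  assumes "i \<ge> 2"
  shows "{\<omega> \<in> space M. Q (T i \<omega>)} \<in> events" "{\<omega> \<in> space M. Q' (V i \<omega>)} \<in> events"
    "{\<omega> \<in> space M. Q' (W i \<omega>)} \<in> events"
  using in_gen_sigma[of M Q "T i"] in_gen_sigma[of M Q' "V i"] in_gen_sigma[of M Q' "W i"]
    subalgebra_gen_sigma[OF T_measurable[OF assms]] subalgebra_gen_sigma[OF V_measurable[OF assms]]
    subalgebra_gen_sigma[OF W_measurable[OF assms]]
  unfolding subalgebra_def by (simp_all add: subset_iff)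

lemma past_generators:
  "(\<Union>i\<in>{2..n}. sets (gen_sigma M (T i))) \<union>
    (\<Union>i\<in>{2..<n}. sets (gen_sigma M (V i)) \<union> sets (gen_sigma M (W i))) \<subseteq> events"
  using subalgebra_gen_sigma[OF T_measurable] subalgebra_gen_sigma[OF V_measurable]
    subalgebra_gen_sigma[OF W_measurable]
  unfolding subalgebra_def by (simp add: UN_subset_iff)

lemma sets_past:
  "sets (past M T V W n) = sigma_sets (space M)
    ((\<Union>i\<in>{2..n}. sets (gen_sigma M (T i))) \<union>
     (\<Union>i\<in>{2..<n}. sets (gen_sigma M (V i)) \<union> sets (gen_sigma M (W i))))"
  unfolding past_def
  by (rule sets_measure_of) (use past_generators[of n] sets.space_closed in blast)

lemma space_past: "space (past M T V W n) = space M"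
  unfolding past_def
  by (rule space_measure_of) (use past_generators[of n] sets.space_closed in blast)

lemma subalgebra_past: "subalgebra M (past M T V W n)"
  unfolding subalgebra_def sets_past
  using sets.sigma_sets_subset[OF past_generators] by (simp add: space_past)

lemma subalgebra_past_with_V:
  assumes "n \<ge> 2"
  shows "subalgebra M (past_with_V M T V W n)"
    and "sets (past M T V W n) \<subseteq> sets (past_with_V M T V W n)"
    and "{\<omega> \<in> space M. Q (V n \<omega>)} \<in> sets (past_with_V M T V W n)"
proof -
  have gen: "sets (past M T V W n) \<union> sets (gen_sigma M (V n)) \<subseteq> events"
    using subalgebra_past[of n] subalgebra_gen_sigma[OF V_measurable[OF assms]]
    by (simp add: subalgebra_def)
  then have pow: "sets (past M T V W n) \<union> sets (gen_sigma M (V n)) \<subseteq> Pow (space M)"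
    using sets.space_closed by blast
  have eq: "sets (past_with_V M T V W n)
      = sigma_sets (space M) (sets (past M T V W n) \<union> sets (gen_sigma M (V n)))"
    unfolding past_with_V_def by (rule sets_measure_of[OF pow])
  show "subalgebra M (past_with_V M T V W n)"
    unfolding subalgebra_def eq
    using sets.sigma_sets_subset[OF gen] space_measure_of[OF pow] by (simp add: past_with_V_def)
  show "sets (past M T V W n) \<subseteq> sets (past_with_V M T V W n)"
    unfolding eq by (auto intro: sigma_sets.Basic)
  show "{\<omega> \<in> space M. Q (V n \<omega>)} \<in> sets (past_with_V M T V W n)"
    unfolding eq by (rule sigma_sets.Basic) (simp add: in_gen_sigma)
qed

lemma past_mono: "m \<le> n \<Longrightarrow> sets (past M T V W m) \<subseteq> sets (past M T V W n)"
  unfolding sets_past by (rule sigma_sets_mono') fastforce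

lemma gen_sigma_subset_past: "2 \<le> i \<Longrightarrow> i \<le> n \<Longrightarrow> sets (gen_sigma M (T i)) \<subseteq> sets (past M T V W n)"
  unfolding sets_past by (rule subsetI, rule sigma_sets.Basic) auto

lemma in_past:
  "2 \<le> i \<Longrightarrow> i \<le> n \<Longrightarrow> {\<omega> \<in> space M. Q (T i \<omega>)} \<in> sets (past M T V W n)"
  using gen_sigma_subset_past[of i n] in_gen_sigma[of M Q "T i"] by blast

lemma restrict_past:
  assumes "B \<in> sets (past M T V W n)" "2 \<le> i" "i \<le> n"
  shows "{\<omega> \<in> B. Q (T i \<omega>)} \<in> sets (past M T V W n)"
proof -
  have "{\<omega> \<in> B. Q (T i \<omega>)} = B \<inter> {\<omega> \<in> space M. Q (T i \<omega>)}"
    using sets.sets_into_space[OF assms(1)] by (auto simp: space_past)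
  then show ?thesis using assms in_past by auto
qed

text \<open>On an event of the past on which \<open>T\<^sub>n = G\<close>, both conditional laws are constant: that of \<open>V\<^sub>n\<close> given
  the past, and that of \<open>W\<^sub>n\<close> given the past and \<open>V\<^sub>n = x\<close>.  So they can be integrated out
  one after the other.\<close>

lemma prob_step:
  assumes n: "n \<ge> 2" and B: "B \<in> sets (past M T V W n)"
  shows "prob {\<omega> \<in> B. T n \<omega> = G \<and> V n \<omega> = x \<and> W n \<omega> = w}
    = prob {\<omega> \<in> B. T n \<omega> = G} * (pmf (pmf_of_set {1..n}) x * pmf (pmf_of_set (neighbours G x)) w)"
proof -
  define B' where "B' = {\<omega> \<in> B. T n \<omega> = G}"
  have B': "B' \<in> sets (past M T V W n)"
    unfolding B'_def using restrict_past[OF B n, of "\<lambda>H. H = G"] by simp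
  have sub: "B' \<subseteq> space M"
    using sets.sets_into_space[OF B'] by (simp add: space_past)
  define C where "C = {\<omega> \<in> B'. V n \<omega> = x}"
  have "C = B' \<inter> {\<omega> \<in> space M. V n \<omega> = x}" using sub by (auto simp: C_def)
  then have C: "C \<in> sets (past_with_V M T V W n)"
    using subalgebra_past_with_V(2)[OF n] B' subalgebra_past_with_V(3)[OF n, of "\<lambda>y. y = x"] by auto
  have "prob {\<omega> \<in> C. W n \<omega> = w} = prob C * pmf (pmf_of_set (neighbours G x)) w"
  proof (rule measure_inter_of_cond_prob[OF subalgebra_past_with_V(1)[OF n] C])
    show "AE \<omega> in M. \<omega> \<in> C \<longrightarrow> cond_prob_given M (past_with_V M T V W n) (\<lambda>\<omega>. W n \<omega> = w) \<omega>
        = pmf (pmf_of_set (neighbours G x)) w"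
      using W_uniform[OF n, of w] by eventually_elim (auto simp: C_def B'_def)
  qed (rule in_events(3)[OF n])
  moreover have "prob C = prob B' * pmf (pmf_of_set {1..n}) x"
    unfolding C_def
  proof (rule measure_inter_of_cond_prob[OF subalgebra_past B'])
    show "AE \<omega> in M. \<omega> \<in> B' \<longrightarrow> cond_prob_given M (past M T V W n) (\<lambda>\<omega>. V n \<omega> = x) \<omega>
        = pmf (pmf_of_set {1..n}) x"
      using V_uniform[OF n, of x] by eventually_elim auto
  qed (rule in_events(2)[OF n])
  moreover have "{\<omega> \<in> C. W n \<omega> = w} = {\<omega> \<in> B. T n \<omega> = G \<and> V n \<omega> = x \<and> W n \<omega> = w}"
    by (auto simp: C_def B'_def)
  ultimately show ?thesis by (simp add: B'_def)
qed

lemma AE_V_range: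
  assumes n: "n \<ge> 2"
  shows "AE \<omega> in M. V n \<omega> \<in> {1..n}"
proof -
  have "AE \<omega> in M. \<forall>x. x \<notin> {1..n} \<longrightarrow> V n \<omega> \<noteq> x"
    unfolding AE_all_countable
  proof
    fix x
    show "AE \<omega> in M. x \<notin> {1..n} \<longrightarrow> V n \<omega> \<noteq> x"
    proof (cases "x \<in> {1..n}")
      case False
      have "prob {\<omega> \<in> space M. V n \<omega> = x} = prob (space M) * 0"
      proof (rule measure_inter_of_cond_prob[OF subalgebra_past])
        show "space M \<in> sets (past M T V W n)" using sets.top[of "past M T V W n"] by (simp add: space_past)
        show "AE \<omega> in M. \<omega> \<in> space M \<longrightarrow> cond_prob_given M (past M T V W n) (\<lambda>\<omega>. V n \<omega> = x) \<omega> = 0"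
          using V_uniform[OF n, of x] False n by (auto simp: pmf_of_set)
      qed (rule in_events(2)[OF n])
      then have "AE \<omega> in M. \<not> V n \<omega> = x"
        using in_events(2)[OF n, of "\<lambda>y. y = x"]
        by (subst AE_iff_measurable[OF _ refl]) (auto simp: emeasure_eq_measure)
      then show ?thesis by eventually_elim simp
    qed simp
  qed
  then show ?thesis by eventually_elim auto
qed

lemma prob_attach:
  assumes n: "n \<ge> 2" and B: "B \<in> sets (past M T V W n)"
  shows "prob {\<omega> \<in> B. T n \<omega> = G \<and> W n \<omega> = w} = prob {\<omega> \<in> B. T n \<omega> = G} * attach_prob n G w"
proof -
  have BM: "B \<in> events" using B subalgebra_past by (auto simp: subalgebra_def)
  have sub: "B \<subseteq> space M" using sets.sets_into_space[OF BM] .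
  define D where "D x = {\<omega> \<in> B. T n \<omega> = G \<and> V n \<omega> = x \<and> W n \<omega> = w}" for x
  have D: "D x \<in> events" for x
  proof -
    have "D x = B \<inter> {\<omega> \<in> space M. T n \<omega> = G} \<inter> {\<omega> \<in> space M. V n \<omega> = x} \<inter> {\<omega> \<in> space M. W n \<omega> = w}"
      using sub by (auto simp: D_def)
    then show ?thesis
      using BM in_events(1)[OF n, of "\<lambda>H. H = G"] in_events(2,3)[OF n, of "\<lambda>y. y = x"]
        in_events(3)[OF n, of "\<lambda>y. y = w"] by auto
  qed
  have "{\<omega> \<in> B. T n \<omega> = G \<and> W n \<omega> = w}
      = B \<inter> {\<omega> \<in> space M. T n \<omega> = G} \<inter> {\<omega> \<in> space M. W n \<omega> = w}"
    using sub by auto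
  then have E: "{\<omega> \<in> B. T n \<omega> = G \<and> W n \<omega> = w} \<in> events"
    using BM in_events(1)[OF n, of "\<lambda>H. H = G"] in_events(3)[OF n, of "\<lambda>y. y = w"] by auto
  have "prob {\<omega> \<in> B. T n \<omega> = G \<and> W n \<omega> = w} = prob (\<Union>x\<in>{1..n}. D x)"
  proof (rule finite_measure_eq_AE)
    show "AE \<omega> in M. (\<omega> \<in> {\<omega> \<in> B. T n \<omega> = G \<and> W n \<omega> = w}) = (\<omega> \<in> (\<Union>x\<in>{1..n}. D x))"
      using AE_V_range[OF n] by eventually_elim (auto simp: D_def)
  qed (use D E in auto)
  also have "\<dots> = (\<Sum>x\<in>{1..n}. prob (D x))"
    using D by (intro finite_measure_finite_Union) (auto simp: disjoint_family_on_def D_def)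
  also have "\<dots> = prob {\<omega> \<in> B. T n \<omega> = G} * attach_prob n G w"
    unfolding D_def prob_step[OF n B] attach_prob_def by (simp add: sum_distrib_left)
  finally show ?thesis .
qed

lemma level_sets_in_events:
  assumes n: "n \<ge> 2" and B: "B \<in> events"
  shows "{\<omega> \<in> B. T n \<omega> = G \<and> W n \<omega> = w} \<in> events" "{\<omega> \<in> B. T n \<omega> = G} \<in> events"
proof -
  have sub: "B \<subseteq> space M" using sets.sets_into_space[OF B] .
  have "{\<omega> \<in> B. T n \<omega> = G \<and> W n \<omega> = w}
      = B \<inter> {\<omega> \<in> space M. T n \<omega> = G} \<inter> {\<omega> \<in> space M. W n \<omega> = w}"
    "{\<omega> \<in> B. T n \<omega> = G} = B \<inter> {\<omega> \<in> space M. T n \<omega> = G}"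
    using sub by auto
  then show "{\<omega> \<in> B. T n \<omega> = G \<and> W n \<omega> = w} \<in> events" "{\<omega> \<in> B. T n \<omega> = G} \<in> events"
    using B in_events(1)[OF n, of "\<lambda>H. H = G"] in_events(3)[OF n, of "\<lambda>y. y = w"] by auto
qed

lemma AE_W_range:
  assumes n: "n \<ge> 2"
  shows "AE \<omega> in M. spanning_graph n (T n \<omega>) \<longrightarrow> W n \<omega> \<in> {1..n}"
proof -
  have "AE \<omega> in M. \<forall>G\<in>{G. spanning_graph n G}. \<forall>w. w \<notin> {1..n} \<longrightarrow> \<not> (T n \<omega> = G \<and> W n \<omega> = w)"
    unfolding AE_ball_countable[OF countable_finite[OF finite_spanning_graphs]] AE_all_countable
  proof (intro ballI allI)
    fix G w assume "G \<in> {G. spanning_graph n G}"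
    then have G: "spanning_graph n G" by simp
    show "AE \<omega> in M. w \<notin> {1..n} \<longrightarrow> \<not> (T n \<omega> = G \<and> W n \<omega> = w)"
    proof (cases "w \<in> {1..n}")
      case False
      then have "neighbours G w = {}" using neighbours_range[OF G, of _ w] by blast
      then have "attach_prob n G w = 0" by (simp add: attach_prob_eq[OF G])
      then have "prob {\<omega> \<in> space M. T n \<omega> = G \<and> W n \<omega> = w} = 0"
        using prob_attach[OF n, of "space M" G w] sets.top[of "past M T V W n"]
        by (simp add: space_past)
      then have "AE \<omega> in M. \<not> (T n \<omega> = G \<and> W n \<omega> = w)"
        using level_sets_in_events(1)[OF n sets.top, of G w]
        by (subst AE_iff_measurable[OF _ refl]) (auto simp: emeasure_eq_measure)
      then show ?thesis by eventually_elim simp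
    qed simp
  qed
  then show ?thesis by eventually_elim auto
qed

lemma AE_spanning_graph:
  assumes "n \<ge> 2"
  shows "AE \<omega> in M. spanning_graph n (T n \<omega>)"
  using assms
proof (induction n rule: nat_induct_at_least)
  case base
  show ?case using T_initial by eventually_elim (simp only: spanning_graph_edge)
next
  case (Suc n)
  show ?case
    using Suc.IH AE_W_range[OF Suc.hyps] T_step[OF Suc.hyps]
    by eventually_elim (use spanning_graph_grow in simp)
qed

section \<open>The submartingale and the frozen degree\<close>

lemma potential_measurable:
  "n \<ge> 2 \<Longrightarrow> (\<lambda>\<omega>. potential k v (T n \<omega>)) \<in> borel_measurable M"
  using measurable_compose[OF T_measurable, of n "potential k v" borel] by simp

text \<open>Testing against the events \<open>B\<close> of the past expresses the submartingale property without a
  conditional expectation.\<close>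

lemma potential_submartingale:
  assumes n: "n \<ge> 2" and v: "v \<in> {1..n}" and k: "k \<ge> 1" and B: "B \<in> sets (past M T V W n)"
  shows "expectation (\<lambda>\<omega>. indicator B \<omega> * potential k v (T n \<omega>))
    \<le> expectation (\<lambda>\<omega>. indicator B \<omega> * potential k v (T (n + 1) \<omega>))"
proof -
  define K where "K = {G. spanning_graph n G}"
  define f where "f = (\<lambda>(G, w). potential k v (insert {n + 1, w} G))"
  have finK: "finite K" by (simp add: K_def finite_spanning_graphs)
  have BM: "B \<in> events" using B subalgebra_past by (auto simp: subalgebra_def)
  have step: "AE \<omega> in M. potential k v (T (n + 1) \<omega>) = f (T n \<omega>, W n \<omega>)"
    using T_step[OF n] by eventually_elim (simp add: f_def)
  have f_meas: "(\<lambda>\<omega>. f (T n \<omega>, W n \<omega>)) \<in> borel_measurable M"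
  proof -
    \<comment> \<open>Measurability on the product holds as one of its factors, the one of \<open>W n\<close>, is countable.\<close>
    have "(\<lambda>(w, G). f (G, w)) \<in> borel_measurable (count_space UNIV \<Otimes>\<^sub>M count_space UNIV)"
      by (rule measurable_pair_measure_countable1) auto
    from measurable_compose[OF measurable_Pair[OF W_measurable[OF n] T_measurable[OF n]] this]
    show ?thesis by simp
  qed
  have "expectation (\<lambda>\<omega>. indicator B \<omega> * potential k v (T n \<omega>))
      = (\<Sum>G\<in>K. potential k v G * prob {\<omega> \<in> B. T n \<omega> = G})"
  proof (rule expectation_finite_valued[OF finK _ _ potential_measurable[OF n] BM])
    show "AE \<omega> in M. \<omega> \<in> B \<longrightarrow> T n \<omega> \<in> K"
      using AE_spanning_graph[OF n] by eventually_elim (simp add: K_def)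
  qed (rule level_sets_in_events(2)[OF n BM])
  also have "\<dots> \<le> (\<Sum>G\<in>K. (\<Sum>w\<in>{1..n}. attach_prob n G w * f (G, w)) * prob {\<omega> \<in> B. T n \<omega> = G})"
    using potential_drift[OF _ v k] by (intro sum_mono mult_right_mono) (auto simp: f_def K_def)
  also have "\<dots> = (\<Sum>G\<in>K. \<Sum>w\<in>{1..n}. f (G, w) * prob {\<omega> \<in> B. T n \<omega> = G \<and> W n \<omega> = w})"
    unfolding prob_attach[OF n B] sum_distrib_right by (simp only: ac_simps)
  also have "\<dots> = (\<Sum>y\<in>K \<times> {1..n}. f y * prob {\<omega> \<in> B. (T n \<omega>, W n \<omega>) = y})"
    by (simp add: sum.cartesian_product split_def prod_eq_iff)
  also have "\<dots> = expectation (\<lambda>\<omega>. indicator B \<omega> * f (T n \<omega>, W n \<omega>))"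
  proof (rule expectation_finite_valued[where f = f and X = "\<lambda>\<omega>. (T n \<omega>, W n \<omega>)",
        symmetric, OF _ _ _ f_meas BM])
    show "AE \<omega> in M. \<omega> \<in> B \<longrightarrow> (T n \<omega>, W n \<omega>) \<in> K \<times> {1..n}"
      using AE_spanning_graph[OF n] AE_W_range[OF n] by eventually_elim (simp add: K_def)
    show "{\<omega> \<in> B. (T n \<omega>, W n \<omega>) = y} \<in> events" for y
      using level_sets_in_events(1)[OF n BM, of "fst y" "snd y"] by (simp add: prod_eq_iff)
  qed (use finK in simp)
  also have "\<dots> = expectation (\<lambda>\<omega>. indicator B \<omega> * potential k v (T (n + 1) \<omega>))"
  proof (rule integral_cong_AE)
    show "AE \<omega> in M. indicator B \<omega> * f (T n \<omega>, W n \<omega>) = indicator B \<omega> * potential k v (T (n + 1) \<omega>)"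
      using step by eventually_elim simp
  qed (use BM f_meas potential_measurable[of "n + 1" k v] n in \<open>auto intro!: borel_measurable_times\<close>)
  finally show ?thesis .
qed

lemma integrable_potential:
  assumes "n \<ge> 2" and "B \<in> events"
  shows "integrable M (\<lambda>\<omega>. indicator B \<omega> * potential k v (T n \<omega>))"
proof (rule integrable_const_bound[of _ 1])
  show "AE \<omega> in M. norm (indicator B \<omega> * potential k v (T n \<omega>)) \<le> 1"
    using potential_nonneg potential_le_1 by (auto simp: indicator_def)
  show "(\<lambda>\<omega>. indicator B \<omega> * potential k v (T n \<omega>)) \<in> borel_measurable M"
    using assms potential_measurable by (intro borel_measurable_times) auto
qed

text \<open>Let \<open>S J\<close> be the part of \<open>A\<close> on which the degree is \<open>k\<close> from time \<open>n\<close> to \<open>n + J\<close>.  Passing from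
  \<open>S J\<close> to \<open>S (Suc J)\<close> loses nothing of the expected potential at time \<open>n + J + 1\<close>, because the
  potential is \<open>0\<close> where the degree differs from \<open>k\<close>.\<close>

lemma prob_degree_frozen:
  assumes n: "n \<ge> 2" and v: "v \<in> {1..n}" and k: "k \<ge> 1" and A: "A \<in> sets (gen_sigma M (T n))"
  shows "weight k 0 ^ k * prob {\<omega> \<in> A. vdegree (T n \<omega>) v = k}
    \<le> prob {\<omega> \<in> A. \<forall>j. vdegree (T (n + j) \<omega>) v = k}"
proof -
  define S where "S J = {\<omega> \<in> A. \<forall>j\<le>J. vdegree (T (n + j) \<omega>) v = k}" for J
  have A_past: "A \<in> sets (past M T V W n)"
    using gen_sigma_subset_past[OF n order_refl] A by blast
  have S_Suc: "S (Suc J) = {\<omega> \<in> S J. vdegree (T (n + Suc J) \<omega>) v = k}" for J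
    by (auto simp: S_def le_Suc_eq)
  have S_past: "S J \<in> sets (past M T V W (n + J))" for J
  proof (induction J)
    case 0
    show ?case
      using restrict_past[OF A_past n order_refl, of "\<lambda>G. vdegree G v = k"] by (simp add: S_def)
  next
    case (Suc J)
    then have "S J \<in> sets (past M T V W (n + Suc J))"
      using past_mono[of "n + J" "n + Suc J"] by auto
    from restrict_past[OF this, of "n + Suc J" "\<lambda>G. vdegree G v = k"] n
    show ?case by (simp add: S_Suc)
  qed
  have S_events: "S J \<in> events" for J
    using S_past subalgebra_past by (auto simp: subalgebra_def)
  define e where "e J = expectation (\<lambda>\<omega>. indicator (S J) \<omega> * potential k v (T (n + J) \<omega>))" for J
  have e_Suc: "e J \<le> e (Suc J)" for J
  proof -
    have "e J \<le> expectation (\<lambda>\<omega>. indicator (S J) \<omega> * potential k v (T (n + Suc J) \<omega>))"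
      using potential_submartingale[OF _ _ k S_past[of J], of v] n v by (simp add: e_def)
    also have "(\<lambda>\<omega>. indicator (S J) \<omega> * potential k v (T (n + Suc J) \<omega>))
        = (\<lambda>\<omega>. indicator (S (Suc J)) \<omega> * potential k v (T (n + Suc J) \<omega>))"
      by (auto simp: fun_eq_iff S_Suc indicator_def potential_def)
    finally show ?thesis by (simp add: e_def)
  qed
  have "weight k 0 ^ k * prob (S 0) = expectation (\<lambda>\<omega>. weight k 0 ^ k * indicator (S 0) \<omega>)"
    using S_events by simp
  also have "\<dots> \<le> e 0"
    unfolding e_def
  proof (rule integral_mono)
    show "integrable M (\<lambda>\<omega>. weight k 0 ^ k * indicator (S 0) \<omega> :: real)"
      using S_events by (intro integrable_mult_right) (simp add: integrable_real_indicator less_top[symmetric])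
    show "integrable M (\<lambda>\<omega>. indicator (S 0) \<omega> * potential k v (T (n + 0) \<omega>))"
      using integrable_potential S_events n by simp
    show "weight k 0 ^ k * indicator (S 0) \<omega> \<le> indicator (S 0) \<omega> * potential k v (T (n + 0) \<omega>)" for \<omega>
      using potential_lower[of "T n \<omega>" v k] by (auto simp: indicator_def S_def)
  qed
  finally have start: "weight k 0 ^ k * prob (S 0) \<le> e 0" .
  have lower: "weight k 0 ^ k * prob (S 0) \<le> prob (S J)" for J
  proof -
    have "e 0 \<le> e J" using lift_Suc_mono_le[of e, OF e_Suc] by simp
    also have "e J \<le> expectation (indicator (S J))"
      unfolding e_def
    proof (rule integral_mono)
      show "integrable M (\<lambda>\<omega>. indicator (S J) \<omega> * potential k v (T (n + J) \<omega>))"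
        using integrable_potential S_events n by simp
      show "integrable M (indicator (S J) :: 'a \<Rightarrow> real)"
        using S_events by (simp add: integrable_real_indicator less_top[symmetric])
      show "indicator (S J) \<omega> * potential k v (T (n + J) \<omega>) \<le> indicator (S J) \<omega>" for \<omega>
        using potential_le_1 by (simp add: indicator_def)
    qed
    also have "\<dots> = prob (S J)" using S_events by simp
    finally show ?thesis using start by simp
  qed
  have "range S \<subseteq> events" using S_events by (simp add: image_subset_iff)
  moreover have "decseq S"
    unfolding decseq_def S_def by (blast intro: order_trans)
  ultimately have "(\<lambda>J. prob (S J)) \<longlonglongrightarrow> prob (\<Inter>J. S J)"
    by (rule finite_Lim_measure_decseq)
  from LIMSEQ_le_const[OF this exI, of 0] lower
  have "weight k 0 ^ k * prob (S 0) \<le> prob (\<Inter>J. S J)" by blast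
  also have "(\<Inter>J. S J) = {\<omega> \<in> A. \<forall>j. vdegree (T (n + j) \<omega>) v = k}"
    by (auto simp: S_def)
  finally show ?thesis by (simp add: S_def)
qed

lemma cond_prob_degree_frozen:
  assumes n: "n \<ge> 2" and v: "v \<in> {1..n}" and k: "k \<ge> 1"
  shows "AE \<omega> in M. weight k 0 ^ k * indicator {\<omega>' \<in> space M. vdegree (T n \<omega>') v = k} \<omega>
    \<le> cond_prob_given M (gen_sigma M (T n)) (\<lambda>\<omega>'. \<forall>j. vdegree (T (n + j) \<omega>') v = k) \<omega>"
proof (rule cond_prob_given_lower_bound[OF subalgebra_gen_sigma[OF T_measurable[OF n]] in_gen_sigma])
  have "{\<omega> \<in> space M. \<forall>j. vdegree (T (n + j) \<omega>) v = k}
      = (\<Inter>j. {\<omega> \<in> space M. vdegree (T (n + j) \<omega>) v = k})" by auto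
  also have "\<dots> \<in> events"
    using in_events(1) n by (intro sets.countable_INT) auto
  finally show "{\<omega> \<in> space M. \<forall>j. vdegree (T (n + j) \<omega>) v = k} \<in> events" .
next
  fix A assume A: "A \<in> sets (gen_sigma M (T n))"
  have "A \<subseteq> space M"
    using sets.sets_into_space[OF A] subalgebra_gen_sigma[OF T_measurable[OF n]]
    by (simp add: subalgebra_def)
  then have "A \<inter> {\<omega> \<in> space M. vdegree (T n \<omega>) v = k} = {\<omega> \<in> A. vdegree (T n \<omega>) v = k}" by auto
  then show "weight k 0 ^ k * prob (A \<inter> {\<omega> \<in> space M. vdegree (T n \<omega>) v = k})
      \<le> prob {\<omega> \<in> A. \<forall>j. vdegree (T (n + j) \<omega>) v = k}"
    using prob_degree_frozen[OF n v k A] by simp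
qed

end

theorem theorem3p4:
  fixes k :: nat
  assumes "k \<ge> 1"
  shows "\<exists>c::real. c > 0 \<and>
    (\<forall>(M :: 'a measure) T V W. random_friend_tree M T V W \<longrightarrow>
      (\<forall>v n. v \<ge> 1 \<longrightarrow> n \<ge> max v 2 \<longrightarrow>
        (AE \<omega> in M.
          cond_prob_given M (gen_sigma M (T n)) (\<lambda>\<omega>'. \<forall>j. vdegree (T (n + j) \<omega>') v = k) \<omega>
            \<ge> c * indicator {\<omega>' \<in> space M. vdegree (T n \<omega>') v = k} \<omega>)))"
proof (intro exI[of _ "weight k 0 ^ k"] conjI allI impI)
  show "weight k 0 ^ k > 0" by (intro zero_less_power weight_pos)
next
  fix M :: "'a measure" and T V W and v n :: nat
  assume "random_friend_tree M T V W" and "v \<ge> 1" and "n \<ge> max v 2"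
  then show "AE \<omega> in M.
      cond_prob_given M (gen_sigma M (T n)) (\<lambda>\<omega>'. \<forall>j. vdegree (T (n + j) \<omega>') v = k) \<omega>
        \<ge> weight k 0 ^ k * indicator {\<omega>' \<in> space M. vdegree (T n \<omega>') v = k} \<omega>"
    using random_friend_tree.cond_prob_degree_frozen[of M T V W n v k] assms by simp
qed

end
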